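(* Let $\lambda,\mu\in\mathbb{R}$, let $f:\mathbb{R}\to\mathbb{R}$ be given by $f(x)=\lfloor\lambda x+\mu\rfloor$, and let $\mathrm{Cyc}(f)$ be the set of all $2$-cycles of $f$. Then $$\mathrm{Cyc}(f)=\begin{cases} \bigcup\limits_{k=1}^{\left\lceil\frac{1}{\lambda+1}\right\rceil-1}\left\{\{x,x+k\}:x\in\left\{\left\lfloor\frac{-\lambda k-\mu+1}{\lambda-1}\right\rfloor+1,\ldots,\left\lfloor\frac{k-\mu}{\lambda-1}\right\rfloor\right\}\right\},&\text{if }-1<\lambda<0;\\ \left\{\{x,-x+\lfloor\mu\rfloor\}:x\in\mathbb{Z}\right\},&\text{if }\lambda=-1;\\ \bigcup\limits_{k=1}^{-\left\lfloor\frac{1}{\lambda+1}\right\rfloor-1}\left\{\{x,x+k\}:x\in\left\{\left\lfloor\frac{k+1-\mu}{\lambda-1}\right\rfloor+1,\ldots,\left\lfloor\frac{-\lambda k-\mu}{\lambda-1}\right\rfloor\right\}\right\},&\text{if }-2<\lambda<-1;\\ \varnothing,&\text{if }\lambda\leqslant-2\text{ or }\lambda\geqslant0. \end{cases}$$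
   Context: $\lfloor\cdot\rfloor$ and $\lceil\cdot\rceil$ denote the floor and ceiling functions, and $f^2=f\circ f$. The set of all $2$-cycles of $f$ is $\mathrm{Cyc}(f):=\{\{x,f(x)\}:f(x)\neq x\text{ and }f^2(x)=x\}$, where $x$ ranges over $\mathbb{R}$. For integers $a,b$, $\{a,\ldots,b\}$ denotes the set of all integers $m$ with $a\leqslant m\leqslant b$, which is empty if $a>b$.
   Formalization: In the case λ = −1, the set is restricted to integers x with x ≠ −x + ⌊μ⌋, since otherwise, when ⌊μ⌋ is even, it would contain the singleton {⌊μ⌋/2}, which is a fixed point and not a 2-cycle. *)

theory Defs
  imports Complex_Main
begin

definition Cyc :: "('a \<Rightarrow> 'a) \<Rightarrow> 'a set set" where
  "Cyc f = {{x, f x} | x. f x \<noteq> x \<and> (f ^^ 2) x = x}"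

end

(*
  A 2-cycle of f consists of two integers x and x + k with k \<ge> 1.  Put d = (1 - lam) x - mu.
  Then f x = x + k says -k - 1 < d \<le> -k, and f (x + k) = x says lam k - 1 < d \<le> lam k.
  The sign of lam + 1 decides which lower and which upper bound are the stronger ones, and
  the two half-open intervals of length 1 meet if and only if |lam + 1| k < 1.
*)
theory Submission
  imports Defs
begin

text \<open>The cycle is encoded by its smaller point and its gap, over the integers. The sign
  condition \<open>1 \<le> k\<close> stays outside: \<open>k = 0\<close> would describe a fixed
  point, and a negative \<open>k\<close> the same cycle seen from its larger point.\<close>

definition floor_cycle :: "real \<Rightarrow> real \<Rightarrow> int \<Rightarrow> int \<Rightarrow> bool" where
  "floor_cycle l m k x \<longleftrightarrow>
     \<lfloor>l * real_of_int x + m\<rfloor> = x + k \<and> \<lfloor>l * real_of_int (x + k) + m\<rfloor> = x"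

text \<open>Both points of a cycle are values of \<open>f\<close>, since \<open>x = f (f x)\<close>,
  and are therefore integers. Taking the smaller one first makes the gap positive.\<close>

lemma Cyc_floor_eq:
  fixes f :: "real \<Rightarrow> real"
  assumes f: "\<And>x. f x = real_of_int \<lfloor>l * x + m\<rfloor>"
  shows "Cyc f = {{real_of_int x, real_of_int (x + k)} | x k. 1 \<le> k \<and> floor_cycle l m k x}"
    (is "_ = ?R")
proof
  show "Cyc f \<subseteq> ?R"
  proof
    fix S assume "S \<in> Cyc f"
    then obtain x where S: "S = {x, f x}" and ne: "f x \<noteq> x" and ffx: "f (f x) = x"
      unfolding Cyc_def by (auto simp: numeral_2_eq_2)
    obtain a b :: int where x: "x = real_of_int a" and fx: "f x = real_of_int b"
      using f ffx by metis
    have b: "\<lfloor>l * real_of_int a + m\<rfloor> = b" and a: "\<lfloor>l * real_of_int b + m\<rfloor> = a"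
      using f[of x] f[of "f x"] x fx ffx by simp_all
    consider "a < b" | "b < a" using ne x fx by force
    then show "S \<in> ?R"
    proof cases
      case 1
      then have "floor_cycle l m (b - a) a" using a b by (simp add: floor_cycle_def)
      moreover have "S = {real_of_int a, real_of_int (a + (b - a))}" by (simp add: S x fx[unfolded x])
      ultimately show ?thesis using 1 by (intro CollectI exI[of _ a] exI[of _ "b - a"]) simp
    next
      case 2
      then have "floor_cycle l m (a - b) b" using a b by (simp add: floor_cycle_def)
      moreover have "S = {real_of_int b, real_of_int (b + (a - b))}"
        by (simp add: S x fx[unfolded x] insert_commute)
      ultimately show ?thesis using 2 by (intro CollectI exI[of _ b] exI[of _ "a - b"]) simp
    qed
  qed
  show "?R \<subseteq> Cyc f"
  proof
    fix S assume "S \<in> ?R"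
    then obtain x k where S: "S = {real_of_int x, real_of_int (x + k)}"
      and k: "1 \<le> k" and c: "floor_cycle l m k x" by blast
    have "f (real_of_int x) = real_of_int (x + k)" "f (real_of_int (x + k)) = real_of_int x"
      using c f unfolding floor_cycle_def by presburger+
    then show "S \<in> Cyc f" using S k unfolding Cyc_def
      by (intro CollectI exI[of _ "real_of_int x"]) (simp add: numeral_2_eq_2)
  qed
qed

lemma floor_cycle_iff:
  "floor_cycle l m k x \<longleftrightarrow>
     - real_of_int k - 1 < (1 - l) * real_of_int x - m \<and> (1 - l) * real_of_int x - m \<le> - real_of_int k \<and>
     l * real_of_int k - 1 < (1 - l) * real_of_int x - m \<and> (1 - l) * real_of_int x - m \<le> l * real_of_int k"
  \<comment> \<open>Once the products are distributed, \<open>l * x\<close> and \<open>l * k\<close>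
    act as atoms and only linear arithmetic remains.\<close>
  unfolding floor_cycle_def floor_eq_iff of_int_add distrib_left left_diff_distrib mult_1_left
  by (safe; linarith)

text \<open>Two half-open intervals of length 1 that share a point have upper ends less than 1
  apart. Here the ends are \<open>l * k\<close> and \<open>- k\<close>, which differ by
  \<open>(l + 1) * k\<close>.\<close>

lemma floor_cycle_bound:
  assumes "floor_cycle l m k x"
  shows "\<bar>(l + 1) * real_of_int k\<bar> < 1"
  using assms unfolding floor_cycle_iff abs_less_iff distrib_right by linarith

lemma no_floor_cycle:
  assumes "l \<le> -2 \<or> l \<ge> 0" and "1 \<le> k"
  shows "\<not> floor_cycle l m k x"
proof
  assume "floor_cycle l m k x"
  then have "\<bar>l + 1\<bar> * \<bar>real_of_int k\<bar> < 1"
    using floor_cycle_bound by (simp add: abs_mult)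
  moreover have "1 * 1 \<le> \<bar>l + 1\<bar> * \<bar>real_of_int k\<bar>"
    using assms by (intro mult_mono) auto
  ultimately show False by linarith
qed

text \<open>Translates the integer ranges of the theorem into bounds on
  \<open>(1 - l) * x - m\<close>. The \<open>+ 1\<close> after the first floor makes the lower bound
  strict, and multiplying by the negative \<open>l - 1\<close> reverses both inequalities.\<close>

lemma mem_int_interval_iff:
  fixes l m a b :: real
  assumes "l < 1"
  shows "x \<in> {\<lfloor>(a - m) / (l - 1)\<rfloor> + 1..\<lfloor>(b - m) / (l - 1)\<rfloor>} \<longleftrightarrow>
     - a < (1 - l) * real_of_int x - m \<and> (1 - l) * real_of_int x - m \<le> - b"
proof -
  have "x \<in> {\<lfloor>(a - m) / (l - 1)\<rfloor> + 1..\<lfloor>(b - m) / (l - 1)\<rfloor>} \<longleftrightarrow>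
      (a - m) / (l - 1) < real_of_int x \<and> real_of_int x \<le> (b - m) / (l - 1)"
    by (auto simp: floor_less_iff le_floor_iff add1_zle_eq)
  then show ?thesis
    using assms by (simp add: neg_divide_less_eq neg_le_divide_eq)
      (simp only: left_diff_distrib right_diff_distrib mult_1_left mult_1_right mult.commute, linarith)
qed

text \<open>Serves both cases with a union over gaps: it leaves only an equivalence for fixed
  \<open>k\<close> and \<open>x\<close> to be checked, in which the bound on \<open>k\<close> and
  the range of \<open>x\<close> count jointly.\<close>

lemma UN_floor_cycles:
  assumes "\<And>k x. 1 \<le> k \<Longrightarrow> k \<le> N \<and> x \<in> I k \<longleftrightarrow> floor_cycle l m k x"
  shows "(\<Union>k \<in> {1..N}. {{real_of_int x, real_of_int (x + k)} | x. x \<in> I k}) =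
    {{real_of_int x, real_of_int (x + k)} | x k. 1 \<le> k \<and> floor_cycle l m k x}"
proof -
  have "(\<Union>k \<in> {1..N}. {{real_of_int x, real_of_int (x + k)} | x. x \<in> I k}) =
      {{real_of_int x, real_of_int (x + k)} | x k. 1 \<le> k \<and> (k \<le> N \<and> x \<in> I k)}"
    by (rule set_eqI) (simp only: UN_iff Bex_def mem_Collect_eq atLeastAtMost_iff, iprover)
  also have "\<dots> = {{real_of_int x, real_of_int (x + k)} | x k. 1 \<le> k \<and> floor_cycle l m k x}"
    \<comment> \<open>The congruence rule supplies \<open>1 \<le> k\<close> while the second
      conjunct is rewritten.\<close>
    by (simp only: assms cong: conj_cong)
  finally show ?thesis .
qed

text \<open>For \<open>l + 1 > 0\<close> and \<open>k \<ge> 1\<close>, \<open>- k < l * k\<close>,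
  so the binding bounds are \<open>l * k - 1\<close> from below and \<open>- k\<close> from
  above.\<close>

lemma Cyc_floor_gt:
  fixes f :: "real \<Rightarrow> real"
  assumes f: "\<And>x. f x = real_of_int \<lfloor>l * x + m\<rfloor>" and l: "-1 < l" "l < 0"
  shows "Cyc f = (\<Union>k \<in> {1..\<lceil>1 / (l + 1)\<rceil> - 1}. {{real_of_int x, real_of_int (x + k)} | x :: int.
    x \<in> {\<lfloor>(- l * real_of_int k - m + 1) / (l - 1)\<rfloor> + 1..\<lfloor>(real_of_int k - m) / (l - 1)\<rfloor>}})"
proof -
  have iff: "k \<le> \<lceil>1 / (l + 1)\<rceil> - 1 \<and>
      x \<in> {\<lfloor>(- l * real_of_int k - m + 1) / (l - 1)\<rfloor> + 1..\<lfloor>(real_of_int k - m) / (l - 1)\<rfloor>}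
      \<longleftrightarrow> floor_cycle l m k x" if k: "1 \<le> k" for k x
  proof -
    \<comment> \<open>Subtracting 1 from the ceiling excludes \<open>k = 1 / (l + 1)\<close>, where
      the two intervals only abut.\<close>
    have "k \<le> \<lceil>1 / (l + 1)\<rceil> - 1 \<longleftrightarrow> (l + 1) * real_of_int k < 1"
      using l by (simp add: le_diff_eq add1_zle_eq less_ceiling_iff less_divide_eq mult.commute)
    moreover have "x \<in> {\<lfloor>(- l * real_of_int k - m + 1) / (l - 1)\<rfloor> + 1..\<lfloor>(real_of_int k - m) / (l - 1)\<rfloor>}
        \<longleftrightarrow> l * real_of_int k - 1 < (1 - l) * real_of_int x - m \<and> (1 - l) * real_of_int x - m \<le> - real_of_int k"
      using l mem_int_interval_iff[of l x "1 - l * real_of_int k" m "real_of_int k"]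
      by (simp add: algebra_simps)
    moreover have "0 \<le> (l + 1) * real_of_int k" using l k by simp
    ultimately show ?thesis
      unfolding floor_cycle_iff distrib_right mult_1_left by linarith
  qed
  show ?thesis
    unfolding Cyc_floor_eq[OF f] by (rule UN_floor_cycles[symmetric]) (rule iff)
qed

text \<open>The mirror image: now \<open>l * k < - k\<close>, so the binding bounds are
  \<open>- k - 1\<close> from below and \<open>l * k\<close> from above.\<close>

lemma Cyc_floor_lt:
  fixes f :: "real \<Rightarrow> real"
  assumes f: "\<And>x. f x = real_of_int \<lfloor>l * x + m\<rfloor>" and l: "l < -1"
  shows "Cyc f = (\<Union>k \<in> {1..- \<lfloor>1 / (l + 1)\<rfloor> - 1}. {{real_of_int x, real_of_int (x + k)} | x :: int.
    x \<in> {\<lfloor>(real_of_int k + 1 - m) / (l - 1)\<rfloor> + 1..\<lfloor>(- l * real_of_int k - m) / (l - 1)\<rfloor>}})"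
proof -
  have iff: "k \<le> - \<lfloor>1 / (l + 1)\<rfloor> - 1 \<and>
      x \<in> {\<lfloor>(real_of_int k + 1 - m) / (l - 1)\<rfloor> + 1..\<lfloor>(- l * real_of_int k - m) / (l - 1)\<rfloor>}
      \<longleftrightarrow> floor_cycle l m k x" if k: "1 \<le> k" for k x
  proof -
    \<comment> \<open>For an integer \<open>- k\<close>, the floor is below it exactly when
      \<open>1 / (l + 1)\<close> is; clearing the negative denominator then reverses the
      inequality.\<close>
    have "k \<le> - \<lfloor>1 / (l + 1)\<rfloor> - 1 \<longleftrightarrow> \<lfloor>1 / (l + 1)\<rfloor> < - k" by linarith
    also have "\<dots> \<longleftrightarrow> - 1 < (l + 1) * real_of_int k"
      using l by (simp add: floor_less_iff neg_divide_less_eq mult.commute minus_less_iff)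
    finally have "k \<le> - \<lfloor>1 / (l + 1)\<rfloor> - 1 \<longleftrightarrow> - 1 < (l + 1) * real_of_int k" .
    moreover have "x \<in> {\<lfloor>(real_of_int k + 1 - m) / (l - 1)\<rfloor> + 1..\<lfloor>(- l * real_of_int k - m) / (l - 1)\<rfloor>}
        \<longleftrightarrow> - real_of_int k - 1 < (1 - l) * real_of_int x - m \<and> (1 - l) * real_of_int x - m \<le> l * real_of_int k"
      using l mem_int_interval_iff[of l x "real_of_int k + 1" m "- l * real_of_int k"]
      by simp
    moreover have "(l + 1) * real_of_int k \<le> 0" using l k by (simp add: mult_le_0_iff)
    ultimately show ?thesis
      unfolding floor_cycle_iff distrib_right mult_1_left by linarith
  qed
  show ?thesis
    unfolding Cyc_floor_eq[OF f] by (rule UN_floor_cycles[symmetric]) (rule iff)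
qed

text \<open>On the integers \<open>f\<close> is the reflection sending \<open>x\<close> to
  \<open>\<lfloor>m\<rfloor> - x\<close>, an involution, so every integer that is not fixed lies on
  a cycle. The side condition removes the centre of the reflection, an integer when
  \<open>\<lfloor>m\<rfloor>\<close> is even, which would contribute a singleton.\<close>

lemma Cyc_floor_minus_one:
  fixes f :: "real \<Rightarrow> real"
  assumes f: "\<And>x. f x = real_of_int \<lfloor>- x + m\<rfloor>"
  shows "Cyc f = {{real_of_int x, real_of_int (- x + \<lfloor>m\<rfloor>)} | x :: int. x \<noteq> - x + \<lfloor>m\<rfloor>}"
proof -
  have fi: "f (real_of_int x) = real_of_int (- x + \<lfloor>m\<rfloor>)" for x
    unfolding f of_int_eq_iff floor_eq_iff by simp
  have "f y \<noteq> y \<and> (f ^^ 2) y = y \<longleftrightarrow> (\<exists>x. y = real_of_int x \<and> x \<noteq> - x + \<lfloor>m\<rfloor>)" for y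
  proof
    assume y: "f y \<noteq> y \<and> (f ^^ 2) y = y"
    then have "f (f y) = y" by (simp add: numeral_2_eq_2)
    then obtain x where "y = real_of_int x" using f by metis
    then show "\<exists>x. y = real_of_int x \<and> x \<noteq> - x + \<lfloor>m\<rfloor>" using y fi[of x] by auto
  next
    assume "\<exists>x. y = real_of_int x \<and> x \<noteq> - x + \<lfloor>m\<rfloor>"
    then obtain x where y: "y = real_of_int x" and "x \<noteq> - x + \<lfloor>m\<rfloor>" by blast
    then have "f y \<noteq> y" using fi[of x] of_int_eq_iff by metis
    moreover have "f (f y) = y" unfolding y fi by simp
    ultimately show "f y \<noteq> y \<and> (f ^^ 2) y = y" by (simp add: numeral_2_eq_2)
  qed
  then have "Cyc f = {{y, f y} | y. \<exists>x. y = real_of_int x \<and> x \<noteq> - x + \<lfloor>m\<rfloor>}"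
    unfolding Cyc_def by simp
  also have "\<dots> = {{real_of_int x, f (real_of_int x)} | x. x \<noteq> - x + \<lfloor>m\<rfloor>}" by blast
  finally show ?thesis unfolding fi .
qed

theorem theorem2:
  fixes lam \<mu> :: real and f :: "real \<Rightarrow> real"
  assumes f: "\<And>x. f x = real_of_int \<lfloor>lam * x + \<mu>\<rfloor>"
  shows
    "(-1 < lam \<and> lam < 0 \<longrightarrow>
        Cyc f = (\<Union>k \<in> {1..\<lceil>1 / (lam + 1)\<rceil> - 1}.
          {{real_of_int x, real_of_int (x + k)} | x :: int.
             x \<in> {\<lfloor>(- lam * real_of_int k - \<mu> + 1) / (lam - 1)\<rfloor> + 1 ..
                  \<lfloor>(real_of_int k - \<mu>) / (lam - 1)\<rfloor>}})) \<and>
     (lam = -1 \<longrightarrow>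
        Cyc f = {{real_of_int x, real_of_int (- x + \<lfloor>\<mu>\<rfloor>)} | x :: int. x \<noteq> - x + \<lfloor>\<mu>\<rfloor>}) \<and>
     (-2 < lam \<and> lam < -1 \<longrightarrow>
        Cyc f = (\<Union>k \<in> {1..- \<lfloor>1 / (lam + 1)\<rfloor> - 1}.
          {{real_of_int x, real_of_int (x + k)} | x :: int.
             x \<in> {\<lfloor>(real_of_int k + 1 - \<mu>) / (lam - 1)\<rfloor> + 1 ..
                  \<lfloor>(- lam * real_of_int k - \<mu>) / (lam - 1)\<rfloor>}})) \<and>
     (lam \<le> -2 \<or> lam \<ge> 0 \<longrightarrow> Cyc f = {})"
proof (intro conjI impI)
  show "Cyc f = {{real_of_int x, real_of_int (- x + \<lfloor>\<mu>\<rfloor>)} | x :: int. x \<noteq> - x + \<lfloor>\<mu>\<rfloor>}"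
    if "lam = -1"
    using f that by (intro Cyc_floor_minus_one) simp
  show "Cyc f = {}" if "lam \<le> -2 \<or> lam \<ge> 0"
    unfolding Cyc_floor_eq[OF f] using no_floor_cycle[OF that] by simp
qed (simp_all only: Cyc_floor_gt[OF f] Cyc_floor_lt[OF f])

end
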